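(* A multiplicative Lie algebra $G$ is Lie capable if and only if $\mathcal{Z}^*(G)=1$.
   Context: A multiplicative Lie algebra is a triple $(G,\cdot,\star)$ where $(G,\cdot)$ is a group (not necessarily abelian) and $\star$ is a binary operation on $G$ such that for all $x,y,z\in G$, writing ${}^xy=xyx^{-1}$: (1) $x\star x=1$; (2) $x\star(yz)=(x\star y)\,{}^y(x\star z)$; (3) $(xy)\star z={}^x(y\star z)\,(x\star z)$; (4) $((x\star y)\star{}^yz)((y\star z)\star{}^zx)((z\star x)\star{}^xy)=1$; (5) ${}^z(x\star y)={}^zx\star{}^zy$. Homomorphisms are group homomorphisms preserving $\star$. Quotients are by ideals, i.e. normal subgroups $H$ with $x\star y\in H$ for all $x\in G$, $y\in H$. $Z(G)$ is the group center, $LZ(G)=\{x\in G: x\star y=1\ \forall y\in G\}$, and $\mathcal{Z}(G)=LZ(G)\cap Z(G)$. $G$ is Lie capable if there exists a multiplicative Lie algebra $E$ with $G\cong E/\mathcal{Z}(E)$ as multiplicative Lie algebras. A central extension of $G$ is a short exact sequence of multiplicative Lie algebras $1\to\ker\phi\to E\xrightarrow{\phi}G\to1$ with $\ker\phi\subseteq\mathcal{Z}(E)$. Define $\mathcal{Z}^*(G)$ as the intersection of $\phi(\mathcal{Z}(E))$ over all central extensions $1\to\ker\phi\to E\xrightarrow{\phi}G\to1$ of $G$. *)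

theory Defs
  imports "HOL-Algebra.Coset"
begin

section \<open>Multiplicative Lie algebras\<close>

record 'a mult_lie = "'a monoid" +
  lstar :: "'a \<Rightarrow> 'a \<Rightarrow> 'a" (infixl "\<star>\<index>" 70)

definition conjugate :: "('a, 'm) monoid_scheme \<Rightarrow> 'a \<Rightarrow> 'a \<Rightarrow> 'a" where
  "conjugate G x y = x \<otimes>\<^bsub>G\<^esub> y \<otimes>\<^bsub>G\<^esub> inv\<^bsub>G\<^esub> x"

locale mult_lie_algebra = group G for G (structure) +
  assumes star_closed [simp, intro]:
      "\<lbrakk>x \<in> carrier G; y \<in> carrier G\<rbrakk> \<Longrightarrow> x \<star> y \<in> carrier G"
    and star_self:
      "x \<in> carrier G \<Longrightarrow> x \<star> x = \<one>"
    and star_mult_right: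
      "\<lbrakk>x \<in> carrier G; y \<in> carrier G; z \<in> carrier G\<rbrakk> \<Longrightarrow>
         x \<star> (y \<otimes> z) = (x \<star> y) \<otimes> conjugate G y (x \<star> z)"
    and star_mult_left:
      "\<lbrakk>x \<in> carrier G; y \<in> carrier G; z \<in> carrier G\<rbrakk> \<Longrightarrow>
         (x \<otimes> y) \<star> z = conjugate G x (y \<star> z) \<otimes> (x \<star> z)"
    and star_jacobi:
      "\<lbrakk>x \<in> carrier G; y \<in> carrier G; z \<in> carrier G\<rbrakk> \<Longrightarrow>
         ((x \<star> y) \<star> conjugate G y z) \<otimes> ((y \<star> z) \<star> conjugate G z x)
           \<otimes> ((z \<star> x) \<star> conjugate G x y) = \<one>"
    and conjugate_star:
      "\<lbrakk>x \<in> carrier G; y \<in> carrier G; z \<in> carrier G\<rbrakk> \<Longrightarrow>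
         conjugate G z (x \<star> y) = conjugate G z x \<star> conjugate G z y"

definition mlie_hom ::
    "('a, 'm) mult_lie_scheme \<Rightarrow> ('b, 'n) mult_lie_scheme \<Rightarrow> ('a \<Rightarrow> 'b) set" where
  "mlie_hom G H = {h \<in> hom G H. \<forall>x\<in>carrier G. \<forall>y\<in>carrier G. h (x \<star>\<^bsub>G\<^esub> y) = h x \<star>\<^bsub>H\<^esub> h y}"

definition mlie_isomorphic ::
    "('a, 'm) mult_lie_scheme \<Rightarrow> ('b, 'n) mult_lie_scheme \<Rightarrow> bool" where
  "mlie_isomorphic G H \<longleftrightarrow> (\<exists>h \<in> mlie_hom G H. bij_betw h (carrier G) (carrier H))"

definition mlie_ideal :: "('a, 'm) mult_lie_scheme \<Rightarrow> 'a set \<Rightarrow> bool" where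
  "mlie_ideal G H \<longleftrightarrow> H \<lhd> G \<and> (\<forall>x\<in>carrier G. \<forall>y\<in>H. x \<star>\<^bsub>G\<^esub> y \<in> H)"

text \<open>When \<open>H\<close> is an ideal, the union defining the star of two cosets is the single coset of
  the star of any two representatives; see \<open>mlie_quotient_star\<close> below.\<close>

definition mlie_quotient :: "('a, 'm) mult_lie_scheme \<Rightarrow> 'a set \<Rightarrow> 'a set mult_lie" where
  "mlie_quotient G H =
     \<lparr>carrier = rcosets\<^bsub>G\<^esub> H, mult = set_mult G, one = H,
      lstar = (\<lambda>A B. \<Union>a\<in>A. \<Union>b\<in>B. H #>\<^bsub>G\<^esub> (a \<star>\<^bsub>G\<^esub> b))\<rparr>"

definition group_center :: "('a, 'm) monoid_scheme \<Rightarrow> 'a set" where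
  "group_center G = {x \<in> carrier G. \<forall>y\<in>carrier G. x \<otimes>\<^bsub>G\<^esub> y = y \<otimes>\<^bsub>G\<^esub> x}"

definition lie_center :: "('a, 'm) mult_lie_scheme \<Rightarrow> 'a set" where
  "lie_center G = {x \<in> carrier G. \<forall>y\<in>carrier G. x \<star>\<^bsub>G\<^esub> y = \<one>\<^bsub>G\<^esub>}"

definition mlie_center :: "('a, 'm) mult_lie_scheme \<Rightarrow> 'a set" where
  "mlie_center G = lie_center G \<inter> group_center G"

definition central_extension ::
    "('e, 'n) mult_lie_scheme \<Rightarrow> ('e \<Rightarrow> 'a) \<Rightarrow> ('a, 'm) mult_lie_scheme \<Rightarrow> bool" where
  "central_extension E \<phi> G \<longleftrightarrow>
     mult_lie_algebra E \<and> mult_lie_algebra G \<and> \<phi> \<in> mlie_hom E G \<and>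
     \<phi> ` carrier E = carrier G \<and> kernel E G \<phi> \<subseteq> mlie_center E"


section \<open>Lie capability and the intersection over central extensions\<close>

text \<open>
  HOL cannot quantify over all types inside a formula, so the algebras \<open>E\<close> in the next two
  definitions have their elements in one fixed type: the terms over \<open>'a\<close> in the operations of
  a multiplicative Lie algebra. This type is large enough that nothing is lost: by
  \<open>lie_capableI\<close> an arbitrary \<open>E\<close>, over any type, witnesses capability, and by
  \<open>Zstar_subset\<close> an arbitrary central extension, over any type, bounds \<open>Zstar G\<close>.
  Both hold because \<open>E\<close> may be replaced by the subalgebra generated by a set of
  representatives of the elements of \<open>G\<close>, which is an image of the type of terms.
\<close>

datatype 'a mlie_term =
    Gen 'a
  | One
  | Inv "'a mlie_term"
  | Mul "'a mlie_term" "'a mlie_term"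
  | Star "'a mlie_term" "'a mlie_term"

definition lie_capable :: "('a, 'm) mult_lie_scheme \<Rightarrow> bool" where
  "lie_capable G \<longleftrightarrow>
     (\<exists>E :: 'a mlie_term mult_lie.
        mult_lie_algebra E \<and> mlie_isomorphic G (mlie_quotient E (mlie_center E)))"

definition Zstar :: "('a, 'm) mult_lie_scheme \<Rightarrow> 'a set" where
  "Zstar G =
     \<Inter> {\<phi> ` mlie_center E | (E :: 'a mlie_term mult_lie) \<phi>. central_extension E \<phi> G}"


section \<open>Quotients by ideals\<close>

context mult_lie_algebra
begin

lemma conjugate_closed [simp, intro]:
  "\<lbrakk>x \<in> carrier G; y \<in> carrier G\<rbrakk> \<Longrightarrow> conjugate G x y \<in> carrier G"
  by (simp add: conjugate_def)

lemma conjugate_one [simp]: "x \<in> carrier G \<Longrightarrow> conjugate G x \<one> = \<one>"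
  by (simp add: conjugate_def)

lemma star_inv_comm:
  assumes [simp]: "x \<in> carrier G" "y \<in> carrier G"
  shows "y \<star> x = inv (x \<star> y)"
proof -
  have "\<one> = (x \<otimes> y) \<star> (x \<otimes> y)" by (simp add: star_self)
  also have "\<dots> = conjugate G x (y \<star> (x \<otimes> y)) \<otimes> (x \<star> (x \<otimes> y))"
    by (subst star_mult_left) simp_all
  also have "y \<star> (x \<otimes> y) = y \<star> x"
    by (subst star_mult_right) (simp_all add: star_self)
  also have "x \<star> (x \<otimes> y) = conjugate G x (x \<star> y)"
    by (subst star_mult_right) (simp_all add: star_self)
  also have "conjugate G x (y \<star> x) \<otimes> conjugate G x (x \<star> y)
      = conjugate G x ((y \<star> x) \<otimes> (x \<star> y))"
    by (simp add: conjugate_def m_assoc flip: m_assoc[of "inv x" x])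
  finally have "conjugate G x ((y \<star> x) \<otimes> (x \<star> y)) = \<one>" by simp
  then have "x \<otimes> ((y \<star> x) \<otimes> (x \<star> y)) = x"
    unfolding conjugate_def by (subst (asm) inv_solve_right') simp_all
  then have "(y \<star> x) \<otimes> (x \<star> y) = \<one>"
    using r_cancel_one by simp
  then show ?thesis
    by (metis assms inv_equality star_closed)
qed

lemma mlie_centerD:
  assumes "z \<in> mlie_center G" "x \<in> carrier G"
  shows "z \<in> carrier G" "z \<star> x = \<one>" "x \<star> z = \<one>" "z \<otimes> x = x \<otimes> z" "conjugate G z x = x"
proof -
  show z: "z \<in> carrier G" and 1: "z \<star> x = \<one>" and 2: "z \<otimes> x = x \<otimes> z"
    using assms by (auto simp: mlie_center_def lie_center_def group_center_def)
  show "x \<star> z = \<one>" using star_inv_comm[OF z assms(2)] 1 by simp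
  show "conjugate G z x = x" using z 2 assms by (simp add: conjugate_def m_assoc)
qed

lemma mlie_centerI:
  assumes "z \<in> carrier G" "\<And>x. x \<in> carrier G \<Longrightarrow> z \<star> x = \<one>"
    "\<And>x. x \<in> carrier G \<Longrightarrow> z \<otimes> x = x \<otimes> z"
  shows "z \<in> mlie_center G"
  using assms by (auto simp: mlie_center_def lie_center_def group_center_def)

lemma star_one [simp]:
  assumes "x \<in> carrier G" shows "x \<star> \<one> = \<one>" "\<one> \<star> x = \<one>"
proof -
  have "(x \<star> \<one>) \<otimes> (x \<star> \<one>) = x \<star> \<one>"
    using star_mult_right[of x \<one> \<one>] assms by (simp add: conjugate_def)
  then show "x \<star> \<one> = \<one>" using assms by (meson l_cancel_one one_closed star_closed)
  then show "\<one> \<star> x = \<one>" using star_inv_comm[of x \<one>] assms by simp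
qed

lemma mlie_center_ideal: "mlie_ideal G (mlie_center G)"
proof -
  note D = mlie_centerD
  have sub: "subgroup (mlie_center G) G"
  proof (rule subgroupI)
    show "mlie_center G \<subseteq> carrier G"
      by (auto simp: mlie_center_def lie_center_def)
    have "\<one> \<in> mlie_center G" by (rule mlie_centerI) auto
    then show "mlie_center G \<noteq> {}" by blast
  next
    fix a assume a: "a \<in> mlie_center G"
    note [simp] = D(1)[OF a one_closed]
    show "inv a \<in> mlie_center G"
    proof (rule mlie_centerI)
      fix x assume x [simp]: "x \<in> carrier G"
      have "\<one> = (a \<otimes> inv a) \<star> x" by simp
      also have "\<dots> = conjugate G a (inv a \<star> x) \<otimes> (a \<star> x)" by (rule star_mult_left) auto
      also have "\<dots> = inv a \<star> x" by (simp add: D[OF a])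
      finally show "inv a \<star> x = \<one>" ..
      show "inv a \<otimes> x = x \<otimes> inv a"
        using D(4)[OF a x] by (metis D(1) a inv_solve_left inv_solve_right m_assoc m_closed x inv_closed)
    qed simp
  next
    fix a b assume a: "a \<in> mlie_center G" and b: "b \<in> mlie_center G"
    note [simp] = D(1)[OF a one_closed] D(1)[OF b one_closed]
    show "a \<otimes> b \<in> mlie_center G"
    proof (rule mlie_centerI)
      fix x assume x [simp]: "x \<in> carrier G"
      show "(a \<otimes> b) \<star> x = \<one>" by (simp add: star_mult_left D(2)[OF a] D(2)[OF b])
      show "a \<otimes> b \<otimes> x = x \<otimes> (a \<otimes> b)"
        by (metis D(4) a b m_assoc x \<open>a \<in> carrier G\<close> \<open>b \<in> carrier G\<close>)
    qed simp
  qed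
  have "mlie_center G \<lhd> G"
  proof (rule normal_invI[OF sub])
    fix x h assume x: "x \<in> carrier G" and h: "h \<in> mlie_center G"
    have "x \<otimes> h \<otimes> inv x = h"
      using D(4)[OF h x] D(1)[OF h x] x by (metis inv_closed m_assoc r_inv r_one)
    then show "x \<otimes> h \<otimes> inv x \<in> mlie_center G" using h by simp
  qed
  moreover have "x \<star> y \<in> mlie_center G" if "x \<in> carrier G" "y \<in> mlie_center G" for x y
    using D(3)[OF that(2,1)] subgroup.one_closed[OF sub] by simp
  ultimately show ?thesis by (simp add: mlie_ideal_def)
qed

lemma mlie_quotient_star:
  assumes H: "mlie_ideal G H" and x [simp]: "x \<in> carrier G" and y [simp]: "y \<in> carrier G"
  shows "(H #> x) \<star>\<^bsub>mlie_quotient G H\<^esub> (H #> y) = H #> (x \<star> y)"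
proof -
  interpret H: normal H G using H by (simp add: mlie_ideal_def)
  have st: "a \<star> h \<in> H" if "a \<in> carrier G" "h \<in> H" for a h
    using H that by (simp add: mlie_ideal_def)
  have st': "h \<star> a \<in> H" if "a \<in> carrier G" "h \<in> H" for a h
    using star_inv_comm[of a h] st[OF that] that by simp
  have ab: "H #> (a \<star> b) = H #> (x \<star> y)" if ab: "a \<in> H #> x" "b \<in> H #> y" for a b
  proof -
    obtain h k where h: "h \<in> H" "a = h \<otimes> x" and k: "k \<in> H" "b = k \<otimes> y"
      using ab by (auto simp: r_coset_def)
    have hk [simp]: "h \<in> carrier G" "k \<in> carrier G" using h k by auto
    have cj: "H #> conjugate G u v = H #> v" if u: "u \<in> H" and v: "v \<in> carrier G" for u v
    proof -
      have u' [simp]: "u \<in> carrier G" using u by simp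
      have "v \<otimes> inv u \<otimes> inv v \<in> H" using u v H.inv_op_closed2 by simp
      then have "u \<otimes> (v \<otimes> inv u \<otimes> inv v) \<in> H" using u by simp
      moreover have "conjugate G u v = (u \<otimes> (v \<otimes> inv u \<otimes> inv v)) \<otimes> v"
        using v by (simp add: conjugate_def m_assoc)
      ultimately have "conjugate G u v \<in> H #> v" by (auto simp: r_coset_def)
      then show ?thesis using repr_independence[OF _ v H.subgroup_axioms] by simp
    qed
    have lm: "H #> (u \<otimes> v) = H #> v" if "u \<in> H" "v \<in> carrier G" for u v
    proof -
      have "u \<otimes> v \<in> H #> v" using that by (auto simp: r_coset_def)
      then show ?thesis using repr_independence[OF _ that(2) H.subgroup_axioms] by simp
    qed
    have rm: "H #> (v \<otimes> u) = H #> v" if u: "u \<in> H" and v: "v \<in> carrier G" for u v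
    proof -
      have "v \<otimes> u = (v \<otimes> u \<otimes> inv v) \<otimes> v" using u v by (simp add: m_assoc)
      then show ?thesis using lm[of "v \<otimes> u \<otimes> inv v" v] H.inv_op_closed2 u v by simp
    qed
    have "a \<star> b = conjugate G h (x \<star> b) \<otimes> (h \<star> b)"
      using h k by (simp add: star_mult_left)
    then have "H #> (a \<star> b) = H #> conjugate G h (x \<star> b)"
      using rm st' h k by simp
    also have "\<dots> = H #> (x \<star> b)" using cj h k by simp
    also have "x \<star> b = (x \<star> k) \<otimes> conjugate G k (x \<star> y)" using k by (simp add: star_mult_right)
    also have "H #> \<dots> = H #> conjugate G k (x \<star> y)" using lm st k by simp
    also have "\<dots> = H #> (x \<star> y)" using cj k by simp
    finally show ?thesis .
  qed
  have ne: "x \<in> H #> x" "y \<in> H #> y" by (simp_all add: rcos_self H.subgroup_axioms)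
  have "(H #> x) \<star>\<^bsub>mlie_quotient G H\<^esub> (H #> y) = (\<Union>a\<in>H #> x. \<Union>b\<in>H #> y. H #> (a \<star> b))"
    by (simp add: mlie_quotient_def)
  also have "\<dots> = (\<Union>a\<in>H #> x. \<Union>b\<in>H #> y. H #> (x \<star> y))"
    by (intro SUP_cong refl ab)
  also have "\<dots> = H #> (x \<star> y)" using ne by blast
  finally show ?thesis .
qed

end

lemma carrier_mlie_quotient: "carrier (mlie_quotient G H) = rcosets\<^bsub>G\<^esub> H"
  and mult_mlie_quotient: "A \<otimes>\<^bsub>mlie_quotient G H\<^esub> B = A <#>\<^bsub>G\<^esub> B"
  and one_mlie_quotient: "\<one>\<^bsub>mlie_quotient G H\<^esub> = H"
  by (simp_all add: mlie_quotient_def)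

lemma mult_lie_algebra_image:
  assumes E: "mult_lie_algebra E" and h: "h \<in> mlie_hom E Q" and Q: "h ` carrier E = carrier Q"
    and one: "h \<one>\<^bsub>E\<^esub> = \<one>\<^bsub>Q\<^esub>"
  shows "mult_lie_algebra Q"
proof -
  interpret E: mult_lie_algebra E by fact
  have hm: "h (x \<otimes>\<^bsub>E\<^esub> y) = h x \<otimes>\<^bsub>Q\<^esub> h y" and hs: "h (x \<star>\<^bsub>E\<^esub> y) = h x \<star>\<^bsub>Q\<^esub> h y"
    if "x \<in> carrier E" "y \<in> carrier E" for x y
    using h that by (auto simp: mlie_hom_def hom_def)
  have hc: "h x \<in> carrier Q" if "x \<in> carrier E" for x using Q that by blast
  interpret Q: group Q
  proof (rule groupI)
    show "\<one>\<^bsub>Q\<^esub> \<in> carrier Q" using hc[of "\<one>\<^bsub>E\<^esub>"] one by simp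
  next
    fix a b assume "a \<in> carrier Q" "b \<in> carrier Q"
    then show "a \<otimes>\<^bsub>Q\<^esub> b \<in> carrier Q"
      unfolding Q[symmetric] by (auto simp flip: hm)
  next
    fix a b c assume "a \<in> carrier Q" "b \<in> carrier Q" "c \<in> carrier Q"
    then show "a \<otimes>\<^bsub>Q\<^esub> b \<otimes>\<^bsub>Q\<^esub> c = a \<otimes>\<^bsub>Q\<^esub> (b \<otimes>\<^bsub>Q\<^esub> c)"
      unfolding Q[symmetric] by (auto simp flip: hm simp: E.m_assoc)
  next
    fix a assume "a \<in> carrier Q"
    then show "\<one>\<^bsub>Q\<^esub> \<otimes>\<^bsub>Q\<^esub> a = a"
      unfolding Q[symmetric] one[symmetric] by (auto simp flip: hm)
  next
    fix a assume "a \<in> carrier Q"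
    then obtain x where x: "x \<in> carrier E" "a = h x" using Q by blast
    then have "h (inv\<^bsub>E\<^esub> x) \<otimes>\<^bsub>Q\<^esub> a = \<one>\<^bsub>Q\<^esub>" by (simp flip: hm one)
    then show "\<exists>b\<in>carrier Q. b \<otimes>\<^bsub>Q\<^esub> a = \<one>\<^bsub>Q\<^esub>" using hc[of "inv\<^bsub>E\<^esub> x"] x by auto
  qed
  have hi: "inv\<^bsub>Q\<^esub> (h x) = h (inv\<^bsub>E\<^esub> x)" if "x \<in> carrier E" for x
    using that by (intro Q.inv_equality) (simp_all flip: hm one add: hc)
  have hcj: "conjugate Q (h x) (h y) = h (conjugate E x y)"
    if "x \<in> carrier E" "y \<in> carrier E" for x y
    using that by (simp add: conjugate_def hi hm)
  show ?thesis
  proof unfold_locales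
    fix a b assume "a \<in> carrier Q" "b \<in> carrier Q"
    then show "a \<star>\<^bsub>Q\<^esub> b \<in> carrier Q" unfolding Q[symmetric] by (auto simp flip: hs)
  next
    fix a assume "a \<in> carrier Q"
    then show "a \<star>\<^bsub>Q\<^esub> a = \<one>\<^bsub>Q\<^esub>"
      unfolding Q[symmetric] by (auto simp flip: hs simp: E.star_self one)
  next
    fix a b c assume "a \<in> carrier Q" "b \<in> carrier Q" "c \<in> carrier Q"
    then obtain x y z where xyz [simp]: "x \<in> carrier E" "y \<in> carrier E" "z \<in> carrier E"
      and [simp]: "a = h x" "b = h y" "c = h z" unfolding Q[symmetric] by blast
    show "a \<star>\<^bsub>Q\<^esub> (b \<otimes>\<^bsub>Q\<^esub> c) = (a \<star>\<^bsub>Q\<^esub> b) \<otimes>\<^bsub>Q\<^esub> conjugate Q b (a \<star>\<^bsub>Q\<^esub> c)"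
      by (simp flip: hm hs add: hcj E.star_mult_right)
    show "(a \<otimes>\<^bsub>Q\<^esub> b) \<star>\<^bsub>Q\<^esub> c = conjugate Q a (b \<star>\<^bsub>Q\<^esub> c) \<otimes>\<^bsub>Q\<^esub> (a \<star>\<^bsub>Q\<^esub> c)"
      by (simp flip: hm hs add: hcj E.star_mult_left)
    show "((a \<star>\<^bsub>Q\<^esub> b) \<star>\<^bsub>Q\<^esub> conjugate Q b c) \<otimes>\<^bsub>Q\<^esub> ((b \<star>\<^bsub>Q\<^esub> c) \<star>\<^bsub>Q\<^esub> conjugate Q c a)
        \<otimes>\<^bsub>Q\<^esub> ((c \<star>\<^bsub>Q\<^esub> a) \<star>\<^bsub>Q\<^esub> conjugate Q a b) = \<one>\<^bsub>Q\<^esub>"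
      by (simp flip: hm hs add: hcj E.star_jacobi one)
    show "conjugate Q c (a \<star>\<^bsub>Q\<^esub> b) = conjugate Q c a \<star>\<^bsub>Q\<^esub> conjugate Q c b"
      by (simp flip: hm hs add: hcj E.conjugate_star)
  qed
qed

lemma (in mult_lie_algebra) mlie_quotient_hom:
  assumes H: "mlie_ideal G H"
  shows "(\<lambda>x. H #> x) \<in> mlie_hom G (mlie_quotient G H)"
    and "(\<lambda>x. H #> x) ` carrier G = carrier (mlie_quotient G H)"
proof -
  interpret H: normal H G using H by (simp add: mlie_ideal_def)
  show "(\<lambda>x. H #> x) ` carrier G = carrier (mlie_quotient G H)"
    by (auto simp: carrier_mlie_quotient RCOSETS_def)
  then show "(\<lambda>x. H #> x) \<in> mlie_hom G (mlie_quotient G H)"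
    by (auto simp: mlie_hom_def hom_def mult_mlie_quotient H.rcos_sum mlie_quotient_star[OF H])
qed

lemma (in mult_lie_algebra) mlie_quotient_algebra:
  assumes H: "mlie_ideal G H"
  shows "mult_lie_algebra (mlie_quotient G H)"
proof -
  interpret H: normal H G using H by (simp add: mlie_ideal_def)
  show ?thesis
    using mult_lie_algebra_image[OF mult_lie_algebra_axioms mlie_quotient_hom[OF H]]
    by (simp add: one_mlie_quotient coset_mult_one H.subset)
qed


section \<open>The type of terms is large enough\<close>

lemma isomorphic_quotient_iff_central_extension:
  assumes E: "mult_lie_algebra E" and G: "mult_lie_algebra G"
  shows "mlie_isomorphic G (mlie_quotient E (mlie_center E)) \<longleftrightarrow>
    (\<exists>\<phi>. central_extension E \<phi> G \<and> kernel E G \<phi> = mlie_center E)" (is "?L \<longleftrightarrow> ?R")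
proof -
  interpret E: mult_lie_algebra E by fact
  interpret G: mult_lie_algebra G by fact
  let ?Z = "mlie_center E" let ?Q = "mlie_quotient E ?Z"
  note Z = E.mlie_center_ideal
  interpret Z: normal ?Z E using Z by (simp add: mlie_ideal_def)
  let ?q = "\<lambda>x. ?Z #>\<^bsub>E\<^esub> x"
  interpret Q: mult_lie_algebra ?Q by (rule E.mlie_quotient_algebra[OF Z])
  have q: "?q \<in> mlie_hom E ?Q" and qs: "?q ` carrier E = carrier ?Q"
    using E.mlie_quotient_hom[OF Z] by auto
  have qe: "?q x = ?q y \<longleftrightarrow> x \<otimes>\<^bsub>E\<^esub> inv\<^bsub>E\<^esub> y \<in> ?Z" if "x \<in> carrier E" "y \<in> carrier E" for x y
  proof
    assume "?q x = ?q y"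
    then have "x \<in> ?q y" using E.rcos_self[OF that(1) Z.subgroup_axioms] by simp
    then show "x \<otimes>\<^bsub>E\<^esub> inv\<^bsub>E\<^esub> y \<in> ?Z"
      using Z.rcos_module[OF E.is_group that(2,1)] by simp
  next
    assume "x \<otimes>\<^bsub>E\<^esub> inv\<^bsub>E\<^esub> y \<in> ?Z"
    then have "x \<in> ?q y" using Z.rcos_module[OF E.is_group that(2,1)] by simp
    then show "?q x = ?q y" using E.repr_independence[OF _ that(2) Z.subgroup_axioms] by simp
  qed
  show ?thesis
  proof
    assume ?L
    then obtain h where h: "h \<in> mlie_hom G ?Q" and bij: "bij_betw h (carrier G) (carrier ?Q)"
      by (auto simp: mlie_isomorphic_def)
    define k where "k = the_inv_into (carrier G) h"
    have inj: "inj_on h (carrier G)" using bij by (simp add: bij_betw_def)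
    have kb: "bij_betw k (carrier ?Q) (carrier G)"
      unfolding k_def by (rule bij_betw_the_inv_into[OF bij])
    have kc: "k A \<in> carrier G" and hk: "h (k A) = A" if "A \<in> carrier ?Q" for A
      using that bij kb unfolding k_def by (auto simp: bij_betw_def f_the_inv_into_f)
    have hI: "k A = g" if "A = h g" "g \<in> carrier G" for A g
      using that inj by (simp add: k_def the_inv_into_f_f)
    have km: "k \<in> mlie_hom ?Q G"
      unfolding mlie_hom_def hom_def
      using h hk kc by (auto intro!: hI simp: mlie_hom_def hom_def)
    let ?f = "\<lambda>x. k (?q x)"
    have f: "?f \<in> mlie_hom E G"
      using q km by (auto simp: mlie_hom_def hom_def Pi_iff)
    have fs: "?f ` carrier E = carrier G"
      using kb by (simp add: bij_betw_def flip: qs) (simp add: image_image)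
    have "k (?q x) = \<one>\<^bsub>G\<^esub> \<longleftrightarrow> x \<in> ?Z" if x: "x \<in> carrier E" for x
    proof -
      have k1: "k (?q \<one>\<^bsub>E\<^esub>) = \<one>\<^bsub>G\<^esub>"
        using f hom_one[of ?f E G] E.is_group G.is_group by (simp add: mlie_hom_def)
      have "k (?q x) = \<one>\<^bsub>G\<^esub> \<longleftrightarrow> k (?q x) = k (?q \<one>\<^bsub>E\<^esub>)" by (simp add: k1)
      also have "\<dots> \<longleftrightarrow> ?q x = ?q \<one>\<^bsub>E\<^esub>"
        using kb qs x by (intro inj_on_eq_iff[of k "carrier ?Q"]) (auto simp: bij_betw_def)
      also have "\<dots> \<longleftrightarrow> x \<in> ?Z" using qe[OF x E.one_closed] x by simp
      finally show ?thesis .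
    qed
    then have "kernel E G ?f = ?Z" using Z.subset by (auto simp: kernel_def)
    then show ?R using E G f fs unfolding central_extension_def by blast
  next
    assume ?R
    then obtain f where f: "f \<in> mlie_hom E G" and fs: "f ` carrier E = carrier G"
      and ker: "kernel E G f = ?Z" by (auto simp: central_extension_def)
    interpret f: group_hom E G f
      using f E.is_group G.is_group
      by (simp add: group_hom_def group_hom_axioms_def mlie_hom_def)
    have fe: "f x = f y \<longleftrightarrow> ?q x = ?q y" if xy: "x \<in> carrier E" "y \<in> carrier E" for x y
    proof -
      have "x \<otimes>\<^bsub>E\<^esub> inv\<^bsub>E\<^esub> y \<in> ?Z \<longleftrightarrow> f x \<otimes>\<^bsub>G\<^esub> inv\<^bsub>G\<^esub> f y = \<one>\<^bsub>G\<^esub>"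
        unfolding ker[symmetric] kernel_def using xy by simp
      also have "\<dots> \<longleftrightarrow> f x = f y"
        using xy f.hom_closed G.inv_solve_right[of "\<one>\<^bsub>G\<^esub>" "f x" "f y"] G.l_one
        by (metis G.one_closed)
      finally show ?thesis using qe[OF xy] by simp
    qed
    define s where "s g = inv_into (carrier E) f g" for g
    have s: "s g \<in> carrier E" "f (s g) = g" if "g \<in> carrier G" for g
      using that fs unfolding s_def by (auto simp: inv_into_into f_inv_into_f)
    let ?h = "\<lambda>g. ?q (s g)"
    have hq: "?h g = ?q x" if "x \<in> carrier E" "f x = g" for g x
      using fe[of "s g" x] that s[of g] by auto
    have fst: "f (x \<star>\<^bsub>E\<^esub> y) = f x \<star>\<^bsub>G\<^esub> f y" if "x \<in> carrier E" "y \<in> carrier E" for x y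
      using f that by (simp add: mlie_hom_def)
    have "?h \<in> mlie_hom G ?Q"
    proof -
      have "?h g \<in> carrier ?Q" if "g \<in> carrier G" for g using qs s that by blast
      moreover have "?h (g \<otimes>\<^bsub>G\<^esub> g') = ?h g \<otimes>\<^bsub>?Q\<^esub> ?h g'" if "g \<in> carrier G" "g' \<in> carrier G" for g g'
        using hq[of "s g \<otimes>\<^bsub>E\<^esub> s g'"] q s that by (simp add: mlie_hom_def hom_def)
      moreover have "?h (g \<star>\<^bsub>G\<^esub> g') = ?h g \<star>\<^bsub>?Q\<^esub> ?h g'" if "g \<in> carrier G" "g' \<in> carrier G" for g g'
        using hq[of "s g \<star>\<^bsub>E\<^esub> s g'"] q s that by (simp add: mlie_hom_def hom_def fst)
      ultimately show ?thesis by (simp add: mlie_hom_def hom_def)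
    qed
    moreover have "bij_betw ?h (carrier G) (carrier ?Q)"
    proof (rule bij_betwI')
      fix g g' assume g: "g \<in> carrier G" "g' \<in> carrier G"
      then show "(?h g = ?h g') = (g = g')" using fe[of "s g" "s g'"] s by simp
    next
      fix g assume "g \<in> carrier G" then show "?h g \<in> carrier ?Q" using qs s by blast
    next
      fix A assume "A \<in> carrier ?Q"
      then obtain x where "x \<in> carrier E" "A = ?q x" using qs by blast
      then show "\<exists>g\<in>carrier G. A = ?h g" using hq[of x "f x"] f.hom_closed by blast
    qed
    ultimately show ?L unfolding mlie_isomorphic_def by blast
  qed
qed

primrec eval_term :: "('e, 'n) mult_lie_scheme \<Rightarrow> ('a \<Rightarrow> 'e) \<Rightarrow> 'a mlie_term \<Rightarrow> 'e" where
  "eval_term E s (Gen a) = s a"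
| "eval_term E s One = \<one>\<^bsub>E\<^esub>"
| "eval_term E s (Inv t) = inv\<^bsub>E\<^esub> (eval_term E s t)"
| "eval_term E s (Mul t u) = eval_term E s t \<otimes>\<^bsub>E\<^esub> eval_term E s u"
| "eval_term E s (Star t u) = eval_term E s t \<star>\<^bsub>E\<^esub> eval_term E s u"

lemma central_extension_transfer:
  fixes E :: "('e, 'n) mult_lie_scheme" and G :: "('a, 'm) mult_lie_scheme"
  assumes "central_extension E \<phi> G"
  obtains E' :: "'a mlie_term mult_lie" and \<psi> where
    "central_extension E' \<psi> G" "\<psi> ` mlie_center E' = \<phi> ` mlie_center E"
    "kernel E G \<phi> = mlie_center E \<Longrightarrow> kernel E' G \<psi> = mlie_center E'"
proof -
  interpret E: mult_lie_algebra E using assms by (simp add: central_extension_def)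
  interpret G: mult_lie_algebra G using assms by (simp add: central_extension_def)
  have phi: "\<phi> \<in> mlie_hom E G" and phis: "\<phi> ` carrier E = carrier G"
    and ker: "kernel E G \<phi> \<subseteq> mlie_center E"
    using assms by (auto simp: central_extension_def)
  interpret p: group_hom E G \<phi>
    using phi E.is_group G.is_group
    by (simp add: group_hom_def group_hom_axioms_def mlie_hom_def)
  have pst: "\<phi> (x \<star>\<^bsub>E\<^esub> y) = \<phi> x \<star>\<^bsub>G\<^esub> \<phi> y" if "x \<in> carrier E" "y \<in> carrier E" for x y
    using phi that by (simp add: mlie_hom_def)
  define s where "s a = (if a \<in> carrier G then inv_into (carrier E) \<phi> a else \<one>\<^bsub>E\<^esub>)" for a
  have sc [simp]: "s a \<in> carrier E" for a
    using phis by (auto simp: s_def inv_into_into)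
  have ps: "\<phi> (s a) = a" if "a \<in> carrier G" for a
    using that phis by (auto simp: s_def f_inv_into_f)
  let ?ev = "eval_term E s"
  have evc [simp]: "?ev t \<in> carrier E" for t by (induction t) auto
  define S where "S = range ?ev"
  have S1: "\<one>\<^bsub>E\<^esub> \<in> S" and Ss: "s a \<in> S" for a
    unfolding S_def by (metis eval_term.simps rangeI)+
  have Sop: "x \<otimes>\<^bsub>E\<^esub> y \<in> S" "x \<star>\<^bsub>E\<^esub> y \<in> S" "inv\<^bsub>E\<^esub> x \<in> S"
    if xy: "x \<in> S" "y \<in> S" for x y
  proof -
    obtain t u where "x = ?ev t" "y = ?ev u" using xy by (auto simp: S_def)
    then have "x \<otimes>\<^bsub>E\<^esub> y = ?ev (Mul t u)" "x \<star>\<^bsub>E\<^esub> y = ?ev (Star t u)" "inv\<^bsub>E\<^esub> x = ?ev (Inv t)"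
      by simp_all
    then show "x \<otimes>\<^bsub>E\<^esub> y \<in> S" "x \<star>\<^bsub>E\<^esub> y \<in> S" "inv\<^bsub>E\<^esub> x \<in> S"
      unfolding S_def by (simp_all only: rangeI)
  qed
  have SE: "x \<in> carrier E" if "x \<in> S" for x using that evc by (auto simp: S_def)
  define j where "j = inv_into UNIV ?ev"
  have ej [simp]: "?ev (j x) = x" if "x \<in> S" for x
    using that by (simp add: j_def S_def f_inv_into_f)
  have jin: "j x = j y \<longleftrightarrow> x = y" if "x \<in> S" "y \<in> S" for x y using ej that by metis

  define ES where "ES = E\<lparr>carrier := S\<rparr>"
  have subS: "subgroup S E"
    using S1 Sop SE by (intro E.subgroupI) auto
  have invS: "inv\<^bsub>ES\<^esub> x = inv\<^bsub>E\<^esub> x" if "x \<in> S" for x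
    unfolding ES_def using E.m_inv_consistent[OF subS that] .
  have grpS: "group ES" unfolding ES_def by (rule E.subgroup_imp_group[OF subS])
  have cjS: "conjugate ES x y = conjugate E x y" if "x \<in> S" for x y
    using invS[OF that] by (simp add: conjugate_def ES_def)
  have algS: "mult_lie_algebra ES"
    apply (rule mult_lie_algebra.intro[OF grpS], unfold_locales)
    using Sop SE cjS E.star_self E.star_mult_left E.star_mult_right E.star_jacobi E.conjugate_star
    by (auto simp: ES_def)

  define E' where "E' = \<lparr>carrier = j ` S, mult = (\<lambda>t u. j (?ev t \<otimes>\<^bsub>E\<^esub> ?ev u)),
    one = j \<one>\<^bsub>E\<^esub>, lstar = (\<lambda>t u. j (?ev t \<star>\<^bsub>E\<^esub> ?ev u))\<rparr>"
  have algE': "mult_lie_algebra E'"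
    by (rule mult_lie_algebra_image[OF algS, of j])
       (auto simp: mlie_hom_def hom_def E'_def ES_def)
  interpret E': mult_lie_algebra E' by (rule algE')
  define psi where "psi = \<phi> \<circ> ?ev"
  have psij: "psi (j x) = \<phi> x" if "x \<in> S" for x using that by (simp add: psi_def)
  have psih: "psi \<in> mlie_hom E' G"
    using Sop SE by (auto simp: mlie_hom_def hom_def E'_def psij pst)
  have psis: "psi ` carrier E' = carrier G"
  proof
    show "psi ` carrier E' \<subseteq> carrier G" using psih by (auto simp: mlie_hom_def hom_def)
    show "carrier G \<subseteq> psi ` carrier E'"
    proof
      fix g assume "g \<in> carrier G"
      then have "g = psi (j (s g))" using psij[OF Ss] ps by simp
      then show "g \<in> psi ` carrier E'" using Ss by (auto simp: E'_def)
    qed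
  qed
  have dec: "\<exists>z\<in>kernel E G \<phi>. y = s (\<phi> y) \<otimes>\<^bsub>E\<^esub> z" if y: "y \<in> carrier E" for y
  proof
    show "inv\<^bsub>E\<^esub> s (\<phi> y) \<otimes>\<^bsub>E\<^esub> y \<in> kernel E G \<phi>"
      using y ps[of "\<phi> y"] by (simp add: kernel_def)
    show "y = s (\<phi> y) \<otimes>\<^bsub>E\<^esub> (inv\<^bsub>E\<^esub> s (\<phi> y) \<otimes>\<^bsub>E\<^esub> y)"
      using y by (simp flip: E.m_assoc)
  qed
  have cen: "mlie_center E' = j ` (mlie_center E \<inter> S)"
  proof
    show "mlie_center E' \<subseteq> j ` (mlie_center E \<inter> S)"
    proof
      fix t assume t: "t \<in> mlie_center E'"
      then obtain x where x: "x \<in> S" "t = j x"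
        using E'.mlie_centerD(1)[OF t E'.one_closed] by (auto simp: E'_def)
      have xE [simp]: "x \<in> carrier E" using SE x by blast
      have cs: "x \<star>\<^bsub>E\<^esub> s a = \<one>\<^bsub>E\<^esub>" "x \<otimes>\<^bsub>E\<^esub> s a = s a \<otimes>\<^bsub>E\<^esub> x" for a
      proof -
        have a: "j (s a) \<in> carrier E'" using Ss by (simp add: E'_def)
        show "x \<star>\<^bsub>E\<^esub> s a = \<one>\<^bsub>E\<^esub>"
          using E'.mlie_centerD(2)[OF t a] x Ss Sop S1 by (simp add: E'_def jin)
        show "x \<otimes>\<^bsub>E\<^esub> s a = s a \<otimes>\<^bsub>E\<^esub> x"
          using E'.mlie_centerD(4)[OF t a] x Ss Sop S1 by (simp add: E'_def jin)
      qed
      have "x \<in> mlie_center E"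
      proof (rule E.mlie_centerI)
        fix y assume "y \<in> carrier E"
        then obtain z where z: "z \<in> mlie_center E" and y: "y = s (\<phi> y) \<otimes>\<^bsub>E\<^esub> z"
          using dec ker by blast
        have zE [simp]: "z \<in> carrier E" using E.mlie_centerD(1)[OF z E.one_closed] .
        have "x \<star>\<^bsub>E\<^esub> (s (\<phi> y) \<otimes>\<^bsub>E\<^esub> z) = \<one>\<^bsub>E\<^esub>"
          by (simp add: E.star_mult_right cs E.mlie_centerD(3)[OF z])
        then show "x \<star>\<^bsub>E\<^esub> y = \<one>\<^bsub>E\<^esub>" using y by simp
        have "x \<otimes>\<^bsub>E\<^esub> (s (\<phi> y) \<otimes>\<^bsub>E\<^esub> z) = s (\<phi> y) \<otimes>\<^bsub>E\<^esub> (x \<otimes>\<^bsub>E\<^esub> z)"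
          by (simp flip: E.m_assoc add: cs)
        also have "\<dots> = s (\<phi> y) \<otimes>\<^bsub>E\<^esub> z \<otimes>\<^bsub>E\<^esub> x"
          by (simp add: E.m_assoc E.mlie_centerD(4)[OF z])
        finally show "x \<otimes>\<^bsub>E\<^esub> y = y \<otimes>\<^bsub>E\<^esub> x" using y by simp
      qed simp
      then show "t \<in> j ` (mlie_center E \<inter> S)" using x by blast
    qed
  next
    show "j ` (mlie_center E \<inter> S) \<subseteq> mlie_center E'"
    proof
      fix t assume "t \<in> j ` (mlie_center E \<inter> S)"
      then obtain x where x: "x \<in> mlie_center E" "x \<in> S" and t: "t = j x" by blast
      show "t \<in> mlie_center E'"
      proof (rule E'.mlie_centerI)
        show "t \<in> carrier E'" using x t by (simp add: E'_def)
        fix u assume "u \<in> carrier E'"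
        then obtain y where y: "y \<in> S" "u = j y" by (auto simp: E'_def)
        show "t \<star>\<^bsub>E'\<^esub> u = \<one>\<^bsub>E'\<^esub>"
          using E.mlie_centerD(2)[OF x(1) SE[OF y(1)]] x y t by (simp add: E'_def)
        show "t \<otimes>\<^bsub>E'\<^esub> u = u \<otimes>\<^bsub>E'\<^esub> t"
          using E.mlie_centerD(4)[OF x(1) SE[OF y(1)]] x y t by (simp add: E'_def)
      qed
    qed
  qed
  have kerE': "kernel E' G psi = j ` (kernel E G \<phi> \<inter> S)"
    using SE by (auto simp: kernel_def E'_def psij)
  have ce: "central_extension E' psi G"
    unfolding central_extension_def
    using algE' G.mult_lie_algebra_axioms psih psis kerE' cen ker by auto
  have im: "psi ` mlie_center E' = \<phi> ` mlie_center E"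
  proof
    show "psi ` mlie_center E' \<subseteq> \<phi> ` mlie_center E" by (auto simp: cen psij)
    show "\<phi> ` mlie_center E \<subseteq> psi ` mlie_center E'"
    proof
      fix g assume "g \<in> \<phi> ` mlie_center E"
      then obtain y where y: "y \<in> mlie_center E" "g = \<phi> y" by blast
      have yE: "y \<in> carrier E" using E.mlie_centerD(1)[OF y(1) E.one_closed] .
      then obtain z where z: "z \<in> kernel E G \<phi>" and yz: "y = s (\<phi> y) \<otimes>\<^bsub>E\<^esub> z"
        using dec by blast
      have zE: "z \<in> carrier E" using z by (simp add: kernel_def)
      interpret Z: subgroup "mlie_center E" E
        using E.mlie_center_ideal by (simp add: mlie_ideal_def normal_imp_subgroup)
      have "s (\<phi> y) = y \<otimes>\<^bsub>E\<^esub> inv\<^bsub>E\<^esub> z"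
        using yz yE zE by (metis E.inv_solve_right sc)
      then have "s (\<phi> y) \<in> mlie_center E" using y z ker by auto
      moreover have "\<phi> (s (\<phi> y)) = g" using ps y yE by simp
      ultimately show "g \<in> psi ` mlie_center E'"
        unfolding cen using psij[OF Ss] Ss by (metis IntI imageI)
    qed
  qed
  show thesis
    using that[OF ce im] kerE' cen by simp
qed

theorem lie_capableI:
  fixes E :: "('e, 'n) mult_lie_scheme" and G :: "('a, 'm) mult_lie_scheme"
  assumes G: "mult_lie_algebra G" and E: "mult_lie_algebra E"
    and "mlie_isomorphic G (mlie_quotient E (mlie_center E))"
  shows "lie_capable G"
proof -
  obtain \<phi> where c: "central_extension E \<phi> G" and k: "kernel E G \<phi> = mlie_center E"
    using assms isomorphic_quotient_iff_central_extension[OF E G] by blast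
  obtain E' :: "'a mlie_term mult_lie" and \<psi>
    where E': "central_extension E' \<psi> G" "kernel E' G \<psi> = mlie_center E'"
    using central_extension_transfer[OF c] k by metis
  then have "mult_lie_algebra E'" by (simp add: central_extension_def)
  then show ?thesis
    using E' isomorphic_quotient_iff_central_extension[OF _ G, of E'] unfolding lie_capable_def
    by blast
qed

theorem Zstar_subset:
  fixes E :: "('e, 'n) mult_lie_scheme" and G :: "('a, 'm) mult_lie_scheme"
  assumes "central_extension E \<phi> G"
  shows "Zstar G \<subseteq> \<phi> ` mlie_center E"
proof -
  obtain E' :: "'a mlie_term mult_lie" and \<psi>
    where "central_extension E' \<psi> G" "\<psi> ` mlie_center E' = \<phi> ` mlie_center E"
    using central_extension_transfer[OF assms] by metis
  then show ?thesis unfolding Zstar_def by blast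
qed

end

(* If Z*(G) = 1, take E to be the fibre product over G of all central extensions of G. It is again
   a central extension of G, and it projects onto each of them. A surjection maps the centre into
   the centre, so the image of the centre of E in G lies in Z*(G) = 1; hence the centre of E is the
   kernel of E -> G. *)
theory Submission
  imports Defs
begin

section \<open>Fibre product over \<open>G\<close> of a family of central extensions\<close>

locale central_extension_family = mult_lie_algebra G for G (structure) +
  fixes I :: "'i set" and E :: "'i \<Rightarrow> ('e, 'n) mult_lie_scheme" and \<phi> :: "'i \<Rightarrow> 'e \<Rightarrow> 'a"
  assumes central_ext: "i \<in> I \<Longrightarrow> central_extension (E i) (\<phi> i) G"
begin

(* The base point is a component of its own so that the fibre product is G when I is empty. *)
definition fibre_product :: "('a \<times> ('i \<Rightarrow> 'e)) mult_lie" where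
  "fibre_product =
     \<lparr>carrier = {(g, f). g \<in> carrier G \<and> f \<in> (\<Pi>\<^sub>E i\<in>I. {x \<in> carrier (E i). \<phi> i x = g})},
      mult = (\<lambda>(g, f) (h, k). (g \<otimes> h, \<lambda>i\<in>I. f i \<otimes>\<^bsub>E i\<^esub> k i)),
      one = (\<one>, \<lambda>i\<in>I. \<one>\<^bsub>E i\<^esub>),
      lstar = (\<lambda>(g, f) (h, k). (g \<star> h, \<lambda>i\<in>I. f i \<star>\<^bsub>E i\<^esub> k i))\<rparr>"

abbreviation P where "P \<equiv> fibre_product"

lemma algebra_E: "i \<in> I \<Longrightarrow> mult_lie_algebra (E i)"
  using central_ext by (simp add: central_extension_def)

lemma group_E: "i \<in> I \<Longrightarrow> group (E i)"
  using algebra_E mult_lie_algebra.axioms(1) by blast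

lemma group_hom_phi: "i \<in> I \<Longrightarrow> group_hom (E i) G (\<phi> i)"
  using central_ext[of i] group_E[of i] is_group
  by (simp add: central_extension_def mlie_hom_def group_hom_def group_hom_axioms_def)

lemma phi_simps:
  assumes "i \<in> I" "x \<in> carrier (E i)" "y \<in> carrier (E i)"
  shows "\<phi> i (x \<otimes>\<^bsub>E i\<^esub> y) = \<phi> i x \<otimes> \<phi> i y" "\<phi> i (x \<star>\<^bsub>E i\<^esub> y) = \<phi> i x \<star> \<phi> i y"
    "\<phi> i (inv\<^bsub>E i\<^esub> x) = inv (\<phi> i x)"
  using central_ext[of i] assms group_hom.hom_inv[OF group_hom_phi]
  by (auto simp: central_extension_def mlie_hom_def hom_def)

lemma phi_one: "i \<in> I \<Longrightarrow> \<phi> i \<one>\<^bsub>E i\<^esub> = \<one>"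
  using group_hom.hom_one[OF group_hom_phi] .

lemma closed_E:
  assumes "i \<in> I"
  shows "\<one>\<^bsub>E i\<^esub> \<in> carrier (E i)"
    "x \<in> carrier (E i) \<Longrightarrow> inv\<^bsub>E i\<^esub> x \<in> carrier (E i)"
    "\<lbrakk>x \<in> carrier (E i); y \<in> carrier (E i)\<rbrakk> \<Longrightarrow> x \<otimes>\<^bsub>E i\<^esub> y \<in> carrier (E i)"
    "\<lbrakk>x \<in> carrier (E i); y \<in> carrier (E i)\<rbrakk> \<Longrightarrow> x \<star>\<^bsub>E i\<^esub> y \<in> carrier (E i)"
proof -
  interpret Ei: mult_lie_algebra "E i" by (rule algebra_E[OF assms])
  show "\<one>\<^bsub>E i\<^esub> \<in> carrier (E i)"
    "x \<in> carrier (E i) \<Longrightarrow> inv\<^bsub>E i\<^esub> x \<in> carrier (E i)"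
    "\<lbrakk>x \<in> carrier (E i); y \<in> carrier (E i)\<rbrakk> \<Longrightarrow> x \<otimes>\<^bsub>E i\<^esub> y \<in> carrier (E i)"
    "\<lbrakk>x \<in> carrier (E i); y \<in> carrier (E i)\<rbrakk> \<Longrightarrow> x \<star>\<^bsub>E i\<^esub> y \<in> carrier (E i)" by auto
qed

lemma carrier_P:
  "p \<in> carrier P \<longleftrightarrow> fst p \<in> carrier G \<and> snd p \<in> extensional I \<and>
     (\<forall>i\<in>I. snd p i \<in> carrier (E i) \<and> \<phi> i (snd p i) = fst p)"
  by (cases p) (auto simp: fibre_product_def PiE_iff)

lemma one_P: "\<one>\<^bsub>P\<^esub> = (\<one>, \<lambda>i\<in>I. \<one>\<^bsub>E i\<^esub>)"
  by (simp add: fibre_product_def)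

lemma mult_P: "p \<otimes>\<^bsub>P\<^esub> q = (fst p \<otimes> fst q, \<lambda>i\<in>I. snd p i \<otimes>\<^bsub>E i\<^esub> snd q i)"
  by (simp add: fibre_product_def case_prod_unfold)

lemma star_P: "p \<star>\<^bsub>P\<^esub> q = (fst p \<star> fst q, \<lambda>i\<in>I. snd p i \<star>\<^bsub>E i\<^esub> snd q i)"
  by (simp add: fibre_product_def case_prod_unfold)

text \<open>Outside \<open>I\<close> extensional functions all take the same default value, so an
  equation in \<open>P\<close> splits into one in \<open>G\<close> and one in each
  \<open>E i\<close>. Every law of \<open>P\<close> is proved through this.\<close>

lemma P_eqI:
  assumes "fst p = fst q" "snd p \<in> extensional I" "snd q \<in> extensional I"
    "\<And>i. i \<in> I \<Longrightarrow> snd p i = snd q i"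
  shows "p = q"
  using assms by (intro prod_eqI extensionalityI[of _ I]) auto

text \<open>Explicit witness for the left inverses that \<open>groupI\<close> asks for. Once
  \<open>P\<close> is a group, uniqueness of inverses identifies it with the inverse of
  \<open>P\<close>.\<close>

definition inv_P where "inv_P p = (inv (fst p), \<lambda>i\<in>I. inv\<^bsub>E i\<^esub> snd p i)"

lemma inv_P_closed: "p \<in> carrier P \<Longrightarrow> inv_P p \<in> carrier P"
  by (auto simp: carrier_P inv_P_def closed_E phi_simps)

lemma inv_P_mult: "p \<in> carrier P \<Longrightarrow> inv_P p \<otimes>\<^bsub>P\<^esub> p = \<one>\<^bsub>P\<^esub>"
  by (rule P_eqI) (auto simp: carrier_P inv_P_def mult_P one_P group.l_inv[OF group_E])

lemma group_P: "group P"
proof (rule groupI)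
  show "\<exists>q\<in>carrier P. q \<otimes>\<^bsub>P\<^esub> p = \<one>\<^bsub>P\<^esub>" if "p \<in> carrier P" for p
    using inv_P_closed inv_P_mult that by blast
  show "p \<otimes>\<^bsub>P\<^esub> q \<otimes>\<^bsub>P\<^esub> r = p \<otimes>\<^bsub>P\<^esub> (q \<otimes>\<^bsub>P\<^esub> r)"
    if "p \<in> carrier P" "q \<in> carrier P" "r \<in> carrier P" for p q r
    using that
    by (intro P_eqI) (auto simp: carrier_P mult_P m_assoc monoid.m_assoc[OF group.is_monoid[OF group_E]])
  show "\<one>\<^bsub>P\<^esub> \<otimes>\<^bsub>P\<^esub> p = p" if "p \<in> carrier P" for p
    using that
    by (intro P_eqI) (auto simp: carrier_P mult_P one_P monoid.l_one[OF group.is_monoid[OF group_E]])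
qed (auto simp: carrier_P mult_P one_P closed_E phi_simps phi_one)

text \<open>Conjugation involves the inverse of \<open>P\<close>, which is componentwise only after
  it has been identified with \<open>inv_P\<close>. With this rule all operations in the axioms are
  componentwise.\<close>

lemma conjugate_P:
  assumes "p \<in> carrier P"
  shows "conjugate P p q
    = (conjugate G (fst p) (fst q), \<lambda>i\<in>I. conjugate (E i) (snd p i) (snd q i))"
proof -
  have "inv\<^bsub>P\<^esub> p = inv_P p"
    using group.inv_equality[OF group_P inv_P_mult] inv_P_closed assms by blast
  then show ?thesis
    by (simp add: conjugate_def mult_P inv_P_def cong: restrict_cong)
qed

text \<open>The axioms are identities, so they are inherited from \<open>G\<close> and from each
  \<open>E i\<close> component by component.\<close>

lemma mult_lie_algebra_P: "mult_lie_algebra P"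
proof (rule mult_lie_algebra.intro[OF group_P], unfold_locales)
  show "p \<star>\<^bsub>P\<^esub> q \<in> carrier P" if "p \<in> carrier P" "q \<in> carrier P" for p q
    using that by (auto simp: carrier_P star_P closed_E phi_simps)
  show "p \<star>\<^bsub>P\<^esub> p = \<one>\<^bsub>P\<^esub>" if "p \<in> carrier P" for p
    using that
    by (intro P_eqI)
      (auto simp: carrier_P star_P one_P star_self mult_lie_algebra.star_self[OF algebra_E])
next
  fix p q r assume p: "p \<in> carrier P" and q: "q \<in> carrier P" and r: "r \<in> carrier P"
  note pqr = p[unfolded carrier_P] q[unfolded carrier_P] r[unfolded carrier_P]
  \<comment> \<open>In the axioms the conjugating element is always one of the three variables, so
    these instances of \<open>conjugate_P\<close> suffice.\<close>
  note P_simps = star_P mult_P one_P conjugate_P[OF p] conjugate_P[OF q] conjugate_P[OF r]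
  show "p \<star>\<^bsub>P\<^esub> (q \<otimes>\<^bsub>P\<^esub> r) = (p \<star>\<^bsub>P\<^esub> q) \<otimes>\<^bsub>P\<^esub> conjugate P q (p \<star>\<^bsub>P\<^esub> r)"
    using pqr by (intro P_eqI)
      (auto simp: P_simps star_mult_right mult_lie_algebra.star_mult_right[OF algebra_E])
  show "(p \<otimes>\<^bsub>P\<^esub> q) \<star>\<^bsub>P\<^esub> r = conjugate P p (q \<star>\<^bsub>P\<^esub> r) \<otimes>\<^bsub>P\<^esub> (p \<star>\<^bsub>P\<^esub> r)"
    using pqr by (intro P_eqI)
      (auto simp: P_simps star_mult_left mult_lie_algebra.star_mult_left[OF algebra_E])
  show "((p \<star>\<^bsub>P\<^esub> q) \<star>\<^bsub>P\<^esub> conjugate P q r) \<otimes>\<^bsub>P\<^esub> ((q \<star>\<^bsub>P\<^esub> r) \<star>\<^bsub>P\<^esub> conjugate P r p)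
      \<otimes>\<^bsub>P\<^esub> ((r \<star>\<^bsub>P\<^esub> p) \<star>\<^bsub>P\<^esub> conjugate P p q) = \<one>\<^bsub>P\<^esub>"
    using pqr by (intro P_eqI)
      (auto simp: P_simps star_jacobi mult_lie_algebra.star_jacobi[OF algebra_E])
  show "conjugate P r (p \<star>\<^bsub>P\<^esub> q) = conjugate P r p \<star>\<^bsub>P\<^esub> conjugate P r q"
    using pqr by (intro P_eqI)
      (auto simp: P_simps conjugate_star mult_lie_algebra.conjugate_star[OF algebra_E])
qed

section \<open>Projections of the fibre product and its centre\<close>

lemma phi_surj:
  assumes "i \<in> I" "g \<in> carrier G"
  obtains x where "x \<in> carrier (E i)" "\<phi> i x = g"
  using central_ext[OF assms(1)] assms(2) unfolding central_extension_def by (metis imageE)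

lemma P_fibre_nonempty:
  assumes g: "g \<in> carrier G"
  obtains f where "(g, f) \<in> carrier P"
proof -
  have "\<forall>i\<in>I. \<exists>x. x \<in> carrier (E i) \<and> \<phi> i x = g"
    using phi_surj[OF _ g] by metis
  then obtain f where "\<forall>i\<in>I. f i \<in> carrier (E i) \<and> \<phi> i (f i) = g" by metis
  \<comment> \<open>The chosen \<open>f\<close> is arbitrary outside \<open>I\<close>; restricting
    it makes it extensional.\<close>
  then have "(g, restrict f I) \<in> carrier P" using g by (simp add: carrier_P)
  then show thesis by (rule that)
qed

lemma P_proj_surj:
  assumes i: "i \<in> I" and x: "x \<in> carrier (E i)"
  obtains p where "p \<in> carrier P" "snd p i = x"
proof -
  have g: "\<phi> i x \<in> carrier G"
    using group_hom.hom_closed[OF group_hom_phi[OF i] x] .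
  obtain f where "(\<phi> i x, f) \<in> carrier P" by (rule P_fibre_nonempty[OF g])
  \<comment> \<open>Any point over \<open>\<phi> i x\<close> may have its coordinate
    \<open>i\<close> replaced by \<open>x\<close>, which lies in the same fibre.\<close>
  then have "(\<phi> i x, f(i := x)) \<in> carrier P"
    using i x by (auto simp: carrier_P extensional_def)
  then show thesis by (rule that) simp
qed

text \<open>Over the base point \<open>\<one>\<close> each coordinate lies in the kernel of
  \<open>\<phi> i\<close>, hence in the centre of \<open>E i\<close>. Central coordinates make a
  central element because the operations are componentwise.\<close>

lemma kernel_P_central: "kernel P G fst \<subseteq> mlie_center P"
proof
  fix p assume "p \<in> kernel P G fst"
  then have p: "p \<in> carrier P" and p1: "fst p = \<one>" by (auto simp: kernel_def)
  have c: "snd p i \<in> mlie_center (E i)" if "i \<in> I" for i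
    using p p1 that central_ext[OF that]
    by (auto simp: carrier_P central_extension_def kernel_def)
  note D = mult_lie_algebra.mlie_centerD[OF algebra_E c]
  show "p \<in> mlie_center P"
  proof (rule mult_lie_algebra.mlie_centerI[OF mult_lie_algebra_P p])
    fix q assume "q \<in> carrier P"
    note q = this[unfolded carrier_P]
    show "p \<star>\<^bsub>P\<^esub> q = \<one>\<^bsub>P\<^esub>"
      using q by (intro P_eqI) (auto simp: star_P one_P p1 D)
    show "p \<otimes>\<^bsub>P\<^esub> q = q \<otimes>\<^bsub>P\<^esub> p"
      using q by (intro P_eqI) (auto simp: mult_P p1 D)
  qed
qed

lemma central_extension_P: "central_extension P fst G"
  unfolding central_extension_def
proof (intro conjI mult_lie_algebra_P mult_lie_algebra_axioms kernel_P_central)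
  show "fst \<in> mlie_hom P G"
    by (auto simp: mlie_hom_def hom_def carrier_P mult_P star_P)
  show "fst ` carrier P = carrier G"
  proof
    show "carrier G \<subseteq> fst ` carrier P"
    proof
      fix g assume "g \<in> carrier G"
      then obtain f where "(g, f) \<in> carrier P" by (rule P_fibre_nonempty)
      then show "g \<in> fst ` carrier P" by (metis fst_conv imageI)
    qed
  qed (auto simp: carrier_P)
qed

text \<open>By \<open>P_proj_surj\<close> every \<open>x\<close> in \<open>E i\<close> is coordinate
  \<open>i\<close> of some \<open>q\<close> in \<open>P\<close>. Reading the centrality equations of
  \<open>p\<close> and \<open>q\<close> at \<open>i\<close> gives those of \<open>snd p i\<close>
  and \<open>x\<close>.\<close>

lemma mlie_center_P_proj:
  assumes p: "p \<in> mlie_center P" and i: "i \<in> I"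
  shows "snd p i \<in> mlie_center (E i)"
proof -
  note D = mult_lie_algebra.mlie_centerD[OF mult_lie_algebra_P p]
  have pc: "p \<in> carrier P"
    using p by (simp add: mlie_center_def lie_center_def)
  show ?thesis
  proof (rule mult_lie_algebra.mlie_centerI[OF algebra_E[OF i]])
    show "snd p i \<in> carrier (E i)" using pc i by (simp add: carrier_P)
    fix x assume "x \<in> carrier (E i)"
    then obtain q where q: "q \<in> carrier P" "snd q i = x" by (rule P_proj_surj[OF i])
    show "snd p i \<star>\<^bsub>E i\<^esub> x = \<one>\<^bsub>E i\<^esub>"
      using arg_cong[OF D(2)[OF q(1)], of "\<lambda>r. snd r i"] q i by (simp add: star_P one_P)
    show "snd p i \<otimes>\<^bsub>E i\<^esub> x = x \<otimes>\<^bsub>E i\<^esub> snd p i"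
      using arg_cong[OF D(4)[OF q(1)], of "\<lambda>r. snd r i"] q i by (simp add: mult_P)
  qed
qed

text \<open>The base point of \<open>p\<close> is the image under \<open>\<phi> i\<close> of its
  coordinate \<open>i\<close>, which is central when \<open>p\<close> is.\<close>

lemma image_mlie_center_P: "fst ` mlie_center P \<subseteq> (\<Inter>i\<in>I. \<phi> i ` mlie_center (E i))"
proof clarify
  fix p i assume p: "p \<in> mlie_center P" and i: "i \<in> I"
  have "p \<in> carrier P" using p by (simp add: mlie_center_def lie_center_def)
  then have "fst p = \<phi> i (snd p i)" using i by (simp add: carrier_P)
  then show "fst p \<in> \<phi> i ` mlie_center (E i)" using mlie_center_P_proj[OF p i] by blast
qed

end

section \<open>Capability and triviality of \<open>Zstar\<close>\<close>

lemma one_in_image_mlie_center: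
  assumes "central_extension E \<phi> G"
  shows "\<one>\<^bsub>G\<^esub> \<in> \<phi> ` mlie_center E"
proof -
  interpret E: mult_lie_algebra E using assms by (simp add: central_extension_def)
  interpret G: mult_lie_algebra G using assms by (simp add: central_extension_def)
  have "\<phi> \<one>\<^bsub>E\<^esub> = \<one>\<^bsub>G\<^esub>"
    using assms hom_one[OF _ E.is_group G.is_group] by (simp add: central_extension_def mlie_hom_def)
  moreover have "\<one>\<^bsub>E\<^esub> \<in> mlie_center E" by (rule E.mlie_centerI) auto
  ultimately show ?thesis by (metis imageI)
qed

theorem corollary4p8:
  fixes G :: "('a, 'm) mult_lie_scheme"
  assumes "mult_lie_algebra G"
  shows "lie_capable G \<longleftrightarrow> Zstar G = {\<one>\<^bsub>G\<^esub>}"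
proof
  assume "lie_capable G"
  then obtain E :: "'a mlie_term mult_lie"
    where E: "mult_lie_algebra E" "mlie_isomorphic G (mlie_quotient E (mlie_center E))"
    unfolding lie_capable_def by blast
  then obtain \<phi> where c: "central_extension E \<phi> G" and k: "kernel E G \<phi> = mlie_center E"
    using isomorphic_quotient_iff_central_extension[OF E(1) assms] by blast
  \<comment> \<open>The centre is the kernel here, so this single extension already bounds
    \<open>Zstar G\<close> by the trivial subgroup.\<close>
  have "\<phi> ` mlie_center E \<subseteq> {\<one>\<^bsub>G\<^esub>}" by (auto simp: kernel_def simp flip: k)
  moreover have "\<one>\<^bsub>G\<^esub> \<in> Zstar G"
    using one_in_image_mlie_center[of _ _ G] by (auto simp: Zstar_def)
  ultimately show "Zstar G = {\<one>\<^bsub>G\<^esub>}" using Zstar_subset[OF c] by blast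
next
  assume Z: "Zstar G = {\<one>\<^bsub>G\<^esub>}"
  define I :: "('a mlie_term mult_lie \<times> ('a mlie_term \<Rightarrow> 'a)) set"
    where "I = {(E, \<phi>). central_extension E \<phi> G}"
  interpret G: mult_lie_algebra G by fact
  \<comment> \<open>The family is indexed by the extensions themselves: an index is a pair of an
    algebra and its map onto \<open>G\<close>, read off by \<open>fst\<close> and
    \<open>snd\<close>.\<close>
  interpret F: central_extension_family G I fst snd
    by unfold_locales (auto simp: I_def)
  let ?P = F.fibre_product
  have "Zstar G = (\<Inter>i\<in>I. snd i ` mlie_center (fst i))"
    unfolding Zstar_def I_def by (rule arg_cong[of _ _ Inter]) force
  then have "fst ` mlie_center ?P \<subseteq> {\<one>\<^bsub>G\<^esub>}"
    using F.image_mlie_center_P Z by simp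
  moreover have "mlie_center ?P \<subseteq> carrier ?P"
    by (auto simp: mlie_center_def lie_center_def)
  \<comment> \<open>A central element of the fibre product has base point in \<open>Zstar G\<close>,
    so its base point is \<open>\<one>\<close>.\<close>
  ultimately have "mlie_center ?P \<subseteq> kernel ?P G fst"
    by (auto simp: kernel_def)
  then have "kernel ?P G fst = mlie_center ?P"
    using F.kernel_P_central by (rule equalityI[rotated])
  then have "mlie_isomorphic G (mlie_quotient ?P (mlie_center ?P))"
    using F.central_extension_P
    by (subst isomorphic_quotient_iff_central_extension[OF F.mult_lie_algebra_P assms])
      (intro exI conjI)
  \<comment> \<open>The elements of \<open>?P\<close> are not terms but pairs with functions on the
    extensions; \<open>lie_capableI\<close> accepts a witness over any type and brings it back to
    terms.\<close>
  then show "lie_capable G"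
    by (rule lie_capableI[OF assms F.mult_lie_algebra_P])
qed

end
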